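(* Let $\mathbb{F}$ be an arbitrary field and let $P(\lambda)=\sum_{k=0}^dP_k\lambda^k\in\mathbb{F}[\lambda]^{n\times n}$ be a regular matrix polynomial of even degree $d\ge2$ with nonsingular leading coefficient $P_d$, and let $t=d/2$. Let $\mathcal{L}(\lambda)$ be a strong linearization of $P(\lambda)$ obtained from a modified block Kronecker pencil, i.e. $$\mathcal{L}(\lambda)=\begin{bmatrix}\lambda B+A&\widehat{L}_t(\lambda)^T\otimes I_n\\ \sigma\widehat{L}_t(\lambda)\otimes I_n&0\end{bmatrix},\qquad\sigma\in\{1,-1\},$$ where $\lambda B+A$ is a $(t+1)n\times(t+1)n$ pencil over $\mathbb{F}$ satisfying $$(\widehat{\Lambda}_t(\lambda)^T\otimes I_n)(\lambda B+A)(\widehat{\Lambda}_t(\lambda)\otimes I_n)=\begin{bmatrix}-P_d&\lambda^tP_d\\ \lambda^tP_d&P(\lambda)-\lambda^dP_d\end{bmatrix}.$$ If $z\in\mathbb{F}^{nd\times1}$ is a right eigenvector of $\mathcal{L}(\lambda)$ with finite eigenvalue $\lambda_0$, then the $(t+1)$th block of $z$ is a right eigenvector of $P(\lambda)$ with finite eigenvalue $\lambda_0$.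
   Context: $\widehat{L}_k(\lambda)\in\mathbb{F}[\lambda]^{(k-1)\times(k+1)}$ is the matrix whose first column is zero and whose $(i,i+1)$ entries are $-1$ and $(i,i+2)$ entries are $\lambda$ ($i=1,\dots,k-1$), all other entries being zero (for $k=1$ it is an empty $0\times 2$ matrix). $\widehat{\Lambda}_k(\lambda)^T=\begin{bmatrix}1&0&\cdots&0&0\\0&\lambda^{k-1}&\cdots&\lambda&1\end{bmatrix}\in\mathbb{F}[\lambda]^{2\times(k+1)}$. A square matrix polynomial is regular if its determinant is not identically zero. Column vectors of size $nd$ are partitioned into $d$ consecutive blocks of size $n$. A right eigenvector of a regular matrix polynomial $R(\lambda)$ with finite eigenvalue $\lambda_0\in\overline{\mathbb{F}}$ is a nonzero vector $x$ with $R(\lambda_0)x=0$. *)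

theory Defs
  imports
    "Jordan_Normal_Form.Determinant"
    "HOL-Algebra.Algebraic_Closure_Type"
begin

text \<open>
  A matrix polynomial over a field is a matrix with polynomial entries, of type
  \<^typ>\<open>'a::field poly mat\<close>. All matrix indices start at 0.
\<close>

definition const_pmat :: "'a::field mat \<Rightarrow> 'a poly mat" where
  "const_pmat M = map_mat (\<lambda>c. [:c:]) M"

definition matrix_poly :: "nat \<Rightarrow> nat \<Rightarrow> (nat \<Rightarrow> 'a::field mat) \<Rightarrow> 'a poly mat" where
  "matrix_poly n d C = mat n n (\<lambda>(i, j). \<Sum>k\<le>d. Polynomial.monom (C k $$ (i, j)) k)"

definition pencil :: "'a::field mat \<Rightarrow> 'a mat \<Rightarrow> 'a poly mat" where
  "pencil B A = [:0, 1:] \<cdot>\<^sub>m const_pmat B + const_pmat A"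

definition regular_pmat :: "'a::field poly mat \<Rightarrow> bool" where
  "regular_pmat R \<longleftrightarrow> square_mat R \<and> det R \<noteq> 0"

definition eval_pmat :: "'a::field poly mat \<Rightarrow> 'a alg_closure \<Rightarrow> 'a alg_closure mat" where
  "eval_pmat R l = map_mat (\<lambda>p. poly (map_poly to_ac p) l) R"

definition right_eigenvector ::
    "'a::field poly mat \<Rightarrow> 'a alg_closure \<Rightarrow> 'a alg_closure vec \<Rightarrow> bool" where
  "right_eigenvector R l x \<longleftrightarrow>
     regular_pmat R \<and> x \<in> carrier_vec (dim_col R) \<and> x \<noteq> 0\<^sub>v (dim_col R) \<and>
     eval_pmat R l *\<^sub>v x = 0\<^sub>v (dim_row R)"

definition kron :: "'a::semiring_1 mat \<Rightarrow> 'a mat \<Rightarrow> 'a mat" (infixl "\<otimes>\<^sub>k" 70) where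
  "M \<otimes>\<^sub>k N = mat (dim_row M * dim_row N) (dim_col M * dim_col N)
     (\<lambda>(i, j). M $$ (i div dim_row N, j div dim_col N) * N $$ (i mod dim_row N, j mod dim_col N))"

definition Lhat :: "nat \<Rightarrow> 'a::field poly mat" where
  "Lhat k = mat (k - 1) (k + 1)
     (\<lambda>(i, j). if j = i + 1 then - 1 else if j = i + 2 then [:0, 1:] else 0)"

text \<open>The row version, of size \<open>2 \<times> (k + 1)\<close>; the block column is its transpose.\<close>

definition Lambdahat_T :: "nat \<Rightarrow> 'a::field poly mat" where
  "Lambdahat_T k = mat 2 (k + 1)
     (\<lambda>(i, j). if i = 0 then (if j = 0 then 1 else 0)
               else (if j = 0 then 0 else Polynomial.monom 1 (k - j)))"

definition modified_block_kronecker ::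
    "nat \<Rightarrow> nat \<Rightarrow> 'a::field \<Rightarrow> 'a mat \<Rightarrow> 'a mat \<Rightarrow> 'a poly mat" where
  "modified_block_kronecker n t \<sigma> B A =
     four_block_mat
       (pencil B A) (transpose_mat (Lhat t) \<otimes>\<^sub>k 1\<^sub>m n)
       (([:\<sigma>:] \<cdot>\<^sub>m Lhat t) \<otimes>\<^sub>k 1\<^sub>m n) (0\<^sub>m ((t - 1) * n) ((t - 1) * n))"

text \<open>
  Strong linearizations: \<open>U L V = diag(I\<^sub>s, P)\<close> with \<open>U\<close>, \<open>V\<close> unimodular, and the same
  for the reversals \<open>rev\<^sub>1 L\<close> and \<open>rev\<^sub>d P\<close>, where the grade-\<open>d\<close> reversal of
  \<open>R(\<lambda>)\<close> is \<open>\<lambda>\<^sup>d R(1/\<lambda>)\<close>.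
\<close>

definition unimodular :: "'a::field poly mat \<Rightarrow> bool" where
  "unimodular U \<longleftrightarrow> square_mat U \<and> (\<exists>c. c \<noteq> 0 \<and> det U = [:c:])"

definition rev_pmat :: "nat \<Rightarrow> 'a::field poly mat \<Rightarrow> 'a poly mat" where
  "rev_pmat d R = map_mat (\<lambda>p. \<Sum>k\<le>d. Polynomial.monom (Polynomial.coeff p (d - k)) k) R"

definition linearization :: "'a::field poly mat \<Rightarrow> 'a poly mat \<Rightarrow> bool" where
  "linearization P L \<longleftrightarrow>
     (\<forall>i < dim_row L. \<forall>j < dim_col L. Polynomial.degree (L $$ (i, j)) \<le> 1) \<and>
     (\<exists>s U V. dim_row L = s + dim_row P \<and> dim_col L = s + dim_col P \<and>
        U \<in> carrier_mat (dim_row L) (dim_row L) \<and> unimodular U \<and>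
        V \<in> carrier_mat (dim_col L) (dim_col L) \<and> unimodular V \<and>
        U * L * V =
          four_block_mat (1\<^sub>m s) (0\<^sub>m s (dim_col P)) (0\<^sub>m (dim_row P) s) P)"

definition strong_linearization :: "nat \<Rightarrow> 'a::field poly mat \<Rightarrow> 'a poly mat \<Rightarrow> bool" where
  "strong_linearization d P L \<longleftrightarrow>
     linearization P L \<and> linearization (rev_pmat d P) (rev_pmat 1 L)"

text \<open>The \<open>i\<close>-th block of length \<open>n\<close>, counting blocks from 1.\<close>

definition vec_block :: "nat \<Rightarrow> nat \<Rightarrow> 'a vec \<Rightarrow> 'a vec" where
  "vec_block n i z = vec n (\<lambda>j. z $ ((i - 1) * n + j))"

end

theory Submission
  imports Defs "Jordan_Normal_Form.Char_Poly"
begin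

unbundle no fps_syntax

text \<open>
  Write an eigenvector as \<open>z = (u; w)\<close>, with \<open>u\<close> made of the first \<open>t + 1\<close> blocks. The lower
  block row of the pencil says that \<open>u = (\<Lambda> \<otimes> I) (u\<^sub>1; u\<^bsub>t+1\<^esub>)\<close>, where \<open>\<Lambda>\<close> is
  \<open>Lambdahat_T\<close> transposed and evaluated at the eigenvalue. Multiplying the upper block row by
  \<open>\<Lambda>\<^sup>T \<otimes> I\<close> removes \<open>w\<close> and leaves \<open>- P\<^sub>d u\<^sub>1 + \<lambda>\<^sup>t P\<^sub>d u\<^bsub>t+1\<^esub> = 0\<close> and
  \<open>\<lambda>\<^sup>t P\<^sub>d u\<^sub>1 + (P(\<lambda>) - \<lambda>\<^sup>d P\<^sub>d) u\<^bsub>t+1\<^esub> = 0\<close>; since \<open>2t = d\<close>, these combine to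
  \<open>P(\<lambda>) u\<^bsub>t+1\<^esub> = 0\<close>. If \<open>u\<^bsub>t+1\<^esub>\<close> vanished, then so would \<open>u\<^sub>1\<close>, because \<open>P\<^sub>d\<close> is
  invertible, hence \<open>u\<close>, hence \<open>w\<close>, because \<open>Lhat\<^sup>T \<otimes> I\<close> is injective.
\<close>

section \<open>Kronecker products and double indexing\<close>

lemma sum_div_mod:
  fixes f :: "nat \<Rightarrow> nat \<Rightarrow> 'a::comm_monoid_add"
  shows "(\<Sum>k<m * n. f (k div n) (k mod n)) = (\<Sum>i<m. \<Sum>j<n. f i j)"
proof -
  \<comment> \<open>The range is cut into \<open>m\<close> consecutive intervals of length
    \<open>n\<close>; on the \<open>i\<close>-th one the quotient is constantly \<open>i\<close> and
    the remainder runs through \<open>{..<n}\<close>.\<close>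
  have "(\<Sum>k<m * n. f (k div n) (k mod n))
      = (\<Sum>i<m. \<Sum>k = i * n..<i * n + n. f (k div n) (k mod n))"
    by (rule sum.nat_group[symmetric])
  also have "\<dots> = (\<Sum>i<m. \<Sum>j<n. f i j)"
  proof (rule sum.cong[OF refl])
    fix i
    have "(\<Sum>k = i * n..<i * n + n. f (k div n) (k mod n))
        = (\<Sum>j = 0..<n. f ((j + i * n) div n) ((j + i * n) mod n))"
      using sum.shift_bounds_nat_ivl[of "\<lambda>k. f (k div n) (k mod n)" 0 "i * n" n]
      by (simp add: add.commute)
    also have "\<dots> = (\<Sum>j<n. f i j)"
      by (rule sum.cong) auto
    finally show "(\<Sum>k = i * n..<i * n + n. f (k div n) (k mod n)) = (\<Sum>j<n. f i j)" .
  qed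
  finally show ?thesis .
qed

lemma block_index_less:
  fixes a b m n :: nat
  assumes "a < m" "b < n"
  shows "a * n + b < m * n"
proof -
  have "a * n + b < Suc a * n" using assms by simp
  also have "\<dots> \<le> m * n" using assms by (intro mult_le_mono1) simp
  finally show ?thesis .
qed

lemma kron_carrier [simp]:
  assumes "M \<in> carrier_mat r c" "N \<in> carrier_mat r' c'"
  shows "M \<otimes>\<^sub>k N \<in> carrier_mat (r * r') (c * c')"
  using assms unfolding kron_def by auto

text \<open>Mixed-product property. Splitting the summation index into quotient and remainder by
  \<open>b'\<close> separates the sum into a product of two sums, one for each pair of
  factors.\<close>

lemma kron_mult_kron:
  fixes M N :: "'a::comm_semiring_1 mat"
  assumes M: "M \<in> carrier_mat a b" and N: "N \<in> carrier_mat b c"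
    and M': "M' \<in> carrier_mat a' b'" and N': "N' \<in> carrier_mat b' c'"
  shows "(M \<otimes>\<^sub>k M') * (N \<otimes>\<^sub>k N') = (M * N) \<otimes>\<^sub>k (M' * N')"
proof (rule eq_matI)
  fix i j
  assume "i < dim_row ((M * N) \<otimes>\<^sub>k (M' * N'))" "j < dim_col ((M * N) \<otimes>\<^sub>k (M' * N'))"
  with assms have i: "i < a * a'" and j: "j < c * c'" by (auto simp: kron_def)
  \<comment> \<open>A valid index rules out an empty product size, so the divisors are positive; the
    bounds on the remainders need this.\<close>
  from i j have pos: "a' > 0" "c' > 0" by (auto intro: gr0I)
  have id: "i div a' < a" "j div c' < c" "i mod a' < a'" "j mod c' < c'"
    using i j pos by (auto simp: less_mult_imp_div_less)
  have "((M \<otimes>\<^sub>k M') * (N \<otimes>\<^sub>k N')) $$ (i, j)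
      = (\<Sum>k<b * b'. (M $$ (i div a', k div b') * M' $$ (i mod a', k mod b'))
          * (N $$ (k div b', j div c') * N' $$ (k mod b', j mod c')))"
    using assms i j by (auto simp: kron_def scalar_prod_def atLeast0LessThan intro!: sum.cong)
  also have "\<dots> = (\<Sum>k<b. \<Sum>k'<b'. (M $$ (i div a', k) * M' $$ (i mod a', k'))
          * (N $$ (k, j div c') * N' $$ (k', j mod c')))"
    by (rule sum_div_mod)
  also have "\<dots> = (\<Sum>k<b. M $$ (i div a', k) * N $$ (k, j div c'))
      * (\<Sum>k'<b'. M' $$ (i mod a', k') * N' $$ (k', j mod c'))"
    by (simp add: sum_product ac_simps)
  also have "\<dots> = ((M * N) \<otimes>\<^sub>k (M' * N')) $$ (i, j)"
    using assms i j id by (simp add: kron_def scalar_prod_def atLeast0LessThan)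
  finally show "((M \<otimes>\<^sub>k M') * (N \<otimes>\<^sub>k N')) $$ (i, j) = ((M * N) \<otimes>\<^sub>k (M' * N')) $$ (i, j)" .
qed (use assms in \<open>auto simp: kron_def\<close>)

text \<open>The identity factor kills every remainder except \<open>b\<close>, so the product acts
  on blocks of length \<open>n\<close> as \<open>M\<close> acts on scalars. With the row index given
  as \<open>a * n + b\<close>, an equation can be read off block by block.\<close>

lemma kron_one_mult_vec:
  fixes M :: "'a::semiring_1 mat"
  assumes M: "M \<in> carrier_mat r c" and x: "x \<in> carrier_vec (c * n)"
    and a: "a < r" and b: "b < n"
  shows "((M \<otimes>\<^sub>k 1\<^sub>m n) *\<^sub>v x) $ (a * n + b) = (\<Sum>j<c. M $$ (a, j) * x $ (j * n + b))"
proof -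
  have i: "a * n + b < r * n" using a b by (rule block_index_less)
  have "((M \<otimes>\<^sub>k 1\<^sub>m n) *\<^sub>v x) $ (a * n + b)
      = (\<Sum>k<c * n. M $$ (a, k div n) * 1\<^sub>m n $$ (b, k mod n) * x $ (k div n * n + k mod n))"
    using assms i by (auto simp: kron_def scalar_prod_def atLeast0LessThan intro!: sum.cong)
  also have "\<dots> = (\<Sum>k<c. \<Sum>k'<n. M $$ (a, k) * 1\<^sub>m n $$ (b, k') * x $ (k * n + k'))"
    by (rule sum_div_mod)
  also have "\<dots> = (\<Sum>k<c. M $$ (a, k) * x $ (k * n + b))"
  proof (rule sum.cong[OF refl])
    fix k
    have "(\<Sum>k'<n. M $$ (a, k) * 1\<^sub>m n $$ (b, k') * x $ (k * n + k'))
        = (\<Sum>k'<n. if k' = b then M $$ (a, k) * x $ (k * n + b) else 0)"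
      using b by (intro sum.cong) auto
    also have "\<dots> = M $$ (a, k) * x $ (k * n + b)" using b by simp
    finally show "(\<Sum>k'<n. M $$ (a, k) * 1\<^sub>m n $$ (b, k') * x $ (k * n + k'))
        = M $$ (a, k) * x $ (k * n + b)" .
  qed
  finally show ?thesis .
qed

section \<open>Evaluation at a point of the algebraic closure\<close>

interpretation to_ac: field_hom to_ac
  by unfold_locales auto

text \<open>Embedding the coefficients and then evaluating composes two ring homomorphisms. This is
  what turns identities between polynomial matrices into identities between matrices over the
  closure.\<close>

interpretation eval_ac: comm_ring_hom "\<lambda>p. poly (map_poly to_ac p) l" for l
proof -
  interpret map_poly_comm_ring_hom to_ac ..
  show "comm_ring_hom (\<lambda>p. poly (map_poly to_ac p) l)"
    by unfold_locales (simp_all add: hom_add hom_mult)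
qed

lemma eval_ac_pCons [simp]:
  "poly (map_poly to_ac (pCons c p)) l = to_ac c + l * poly (map_poly to_ac p) l"
  by (simp add: to_ac.map_poly_pCons_hom)

lemma eval_pmat_carrier [simp]: "eval_pmat R l \<in> carrier_mat r c \<longleftrightarrow> R \<in> carrier_mat r c"
  by (simp add: eval_pmat_def)

lemma eval_pmat_mult:
  assumes "R \<in> carrier_mat a b" "S \<in> carrier_mat b c"
  shows "eval_pmat (R * S) l = eval_pmat R l * eval_pmat S l"
  unfolding eval_pmat_def by (rule eval_ac.mat_hom_mult[OF assms])

lemma eval_pmat_zero [simp]: "eval_pmat (0\<^sub>m r c) l = 0\<^sub>m r c"
  by (auto simp: eval_pmat_def intro!: eq_matI)

lemma eval_pmat_const [simp]: "eval_pmat (const_pmat M) l = map_mat to_ac M"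
  by (auto simp: eval_pmat_def const_pmat_def intro!: eq_matI)

lemma eval_pmat_smult:
  "eval_pmat (p \<cdot>\<^sub>m R) l = poly (map_poly to_ac p) l \<cdot>\<^sub>m eval_pmat R l"
  by (auto simp: eval_pmat_def eval_ac.hom_mult intro!: eq_matI)

lemma eval_pmat_diff:
  assumes "R \<in> carrier_mat r c" "S \<in> carrier_mat r c"
  shows "eval_pmat (R - S) l = eval_pmat R l - eval_pmat S l"
  using assms by (auto simp: eval_pmat_def eval_ac.hom_minus intro!: eq_matI)

text \<open>Evaluation fixes the entries 0 and 1 of the identity factor, so it only touches
  \<open>R\<close>; the blockwise formula \<open>kron_one_mult_vec\<close> then applies to evaluated
  matrices.\<close>

lemma eval_pmat_kron_one: "eval_pmat (R \<otimes>\<^sub>k 1\<^sub>m n) l = eval_pmat R l \<otimes>\<^sub>k 1\<^sub>m n"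
proof (rule eq_matI)
  fix i j
  assume "i < dim_row (eval_pmat R l \<otimes>\<^sub>k 1\<^sub>m n)" "j < dim_col (eval_pmat R l \<otimes>\<^sub>k 1\<^sub>m n)"
  then have ij: "i < dim_row R * n" "j < dim_col R * n" by (auto simp: eval_pmat_def kron_def)
  then have "n > 0" by (auto intro: gr0I)
  with ij have "i div n < dim_row R" "j div n < dim_col R" "i mod n < n" "j mod n < n"
    by (auto simp: less_mult_imp_div_less)
  with ij show "eval_pmat (R \<otimes>\<^sub>k 1\<^sub>m n) l $$ (i, j) = (eval_pmat R l \<otimes>\<^sub>k 1\<^sub>m n) $$ (i, j)"
    by (simp add: eval_pmat_def kron_def)
qed (auto simp: eval_pmat_def kron_def)

section \<open>The dual pair \<open>Lhat\<close> and \<open>Lambdahat_T\<close>\<close>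

lemma Lhat_carrier [simp]: "Lhat k \<in> carrier_mat (k - Suc 0) (Suc k)"
  by (simp add: Lhat_def)

lemma Lambdahat_T_carrier [simp]: "Lambdahat_T k \<in> carrier_mat 2 (Suc k)"
  by (simp add: Lambdahat_T_def)

text \<open>A row has only two nonzero entries, and the bound on \<open>a\<close> keeps both of
  their columns within range.\<close>

lemma sum_Lhat_row:
  fixes f :: "nat \<Rightarrow> 'a::field alg_closure"
  assumes "a < k - 1"
  shows "(\<Sum>j<k + 1. eval_pmat (Lhat k) l $$ (a, j) * f j)
    = - f (a + 1) + l * f (a + 2)"
proof -
  have "(\<Sum>j<k + 1. eval_pmat (Lhat k :: 'a poly mat) l $$ (a, j) * f j)
      = (\<Sum>j<k + 1. (if j = a + 1 then - f j else 0) + (if j = a + 2 then l * f j else 0))"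
    using assms
    by (intro sum.cong) (auto simp: eval_pmat_def Lhat_def eval_ac.hom_uminus)
  also have "\<dots> = - f (a + 1) + l * f (a + 2)"
    using assms unfolding sum.distrib by (auto simp: sum.delta)
  finally show ?thesis .
qed

text \<open>A row of \<open>Lhat\<close> pairs two neighbouring powers with weights -1 and
  \<lambda>, and these cancel. The first row of \<open>Lambdahat_T\<close> is supported in column 0,
  where \<open>Lhat\<close> vanishes.\<close>

lemma Lambdahat_T_mult_Lhat:
  "Lambdahat_T k * transpose_mat (Lhat k) = (0\<^sub>m 2 (k - 1) :: 'a::field poly mat)"
proof (rule eq_matI)
  fix i j
  assume "i < dim_row (0\<^sub>m 2 (k - 1) :: 'a poly mat)" "j < dim_col (0\<^sub>m 2 (k - 1) :: 'a poly mat)"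
  then have i: "i < 2" and j: "j < k - 1" by auto
  let ?L = "Lambdahat_T k :: 'a poly mat"
  have "(?L * transpose_mat (Lhat k)) $$ (i, j) = (\<Sum>m<k + 1. ?L $$ (i, m) * Lhat k $$ (j, m))"
    using i j by (simp add: Lambdahat_T_def Lhat_def scalar_prod_def atLeast0LessThan)
  also have "\<dots> = (\<Sum>m<k + 1. (if m = j + 1 then - ?L $$ (i, m) else 0)
      + (if m = j + 2 then ?L $$ (i, m) * [:0, 1:] else 0))"
    using j by (intro sum.cong) (auto simp: Lhat_def)
  also have "\<dots> = - ?L $$ (i, j + 1) + ?L $$ (i, j + 2) * [:0, 1:]"
    using j unfolding sum.distrib by (auto simp: sum.delta)
  also have "\<dots> = 0"
  proof (cases "i = 0")
    case False
    \<comment> \<open>Since \<open>j < k - 1\<close>, the subtraction \<open>k - Suc (Suc j)\<close>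
      is not truncated, so the two exponents really differ by one.\<close>
    have "Polynomial.monom 1 (k - Suc j) = (Polynomial.monom 1 (k - Suc (Suc j)) * [:0, 1:] :: 'a poly)"
      using j by (simp add: Suc_diff_Suc flip: monom_Suc)
    then show ?thesis using i j False by (simp add: Lambdahat_T_def)
  qed (use i j in \<open>simp add: Lambdahat_T_def\<close>)
  finally show "(?L * transpose_mat (Lhat k)) $$ (i, j) = 0\<^sub>m 2 (k - 1) $$ (i, j)"
    using i j by simp
qed (auto simp: Lambdahat_T_def Lhat_def)

text \<open>The two rows of \<open>Lambdahat_T\<close> have disjoint supports, so each block of the
  product sees only one of \<open>x\<close> and \<open>y\<close>.\<close>

lemma Lambdahat_mult_append_vec:
  fixes l :: "'a::field alg_closure"
  assumes x: "x \<in> carrier_vec n" and y: "y \<in> carrier_vec n" and j: "j < k + 1" and b: "b < n"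
  shows "(eval_pmat (transpose_mat (Lambdahat_T k) \<otimes>\<^sub>k 1\<^sub>m n) l *\<^sub>v (x @\<^sub>v y)) $ (j * n + b)
    = (if j = 0 then x $ b else l ^ (k - j) * y $ b)"
proof -
  have xy: "x @\<^sub>v y \<in> carrier_vec (2 * n)" using append_carrier_vec[OF x y] by (simp add: mult_2)
  have "eval_pmat (transpose_mat (Lambdahat_T k)) l \<in> carrier_mat (k + 1) 2" by simp
  from kron_one_mult_vec[OF this xy j b] x y j b show ?thesis
    unfolding eval_pmat_kron_one by (auto simp: eval_pmat_def Lambdahat_T_def numeral_2_eq_2 poly_monom)
qed

text \<open>Block row \<open>a\<close> says that block \<open>a + 1\<close> is \<open>l\<close>
  times block \<open>a + 2\<close>, counting from 0. Hence the last block determines all blocks but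
  block 0, which is free because column 0 of \<open>Lhat\<close> vanishes; these two blocks are the
  parameters.\<close>

lemma Lhat_kernel:
  fixes l :: "'a::field alg_closure"
  assumes u: "u \<in> carrier_vec ((k + 1) * n)"
    and 0: "eval_pmat (Lhat k \<otimes>\<^sub>k 1\<^sub>m n) l *\<^sub>v u = 0\<^sub>v ((k - 1) * n)"
  shows "u = eval_pmat (transpose_mat (Lambdahat_T k) \<otimes>\<^sub>k 1\<^sub>m n) l
    *\<^sub>v (vec_block n 1 u @\<^sub>v vec_block n (k + 1) u)" (is "u = ?M *\<^sub>v (?x @\<^sub>v ?y)")
proof (rule eq_vecI)
  have M: "?M \<in> carrier_mat ((k + 1) * n) (2 * n)"
    unfolding eval_pmat_carrier by (intro kron_carrier) auto
  then show "dim_vec u = dim_vec (?M *\<^sub>v (?x @\<^sub>v ?y))" using u by simp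
  fix i assume "i < dim_vec (?M *\<^sub>v (?x @\<^sub>v ?y))"
  with M have i: "i < (k + 1) * n" by simp
  then have n: "n > 0" by (auto intro: gr0I)
  define j b where "j = i div n" and "b = i mod n"
  have b: "b < n" and j: "j < k + 1" and ij: "i = j * n + b"
    using n i by (auto simp: b_def j_def less_mult_imp_div_less)
  have step: "u $ ((a + 1) * n + b) = l * u $ ((a + 2) * n + b)" if a: "a < k - 1" for a
  proof -
    have E: "eval_pmat (Lhat k :: 'a poly mat) l \<in> carrier_mat (k - 1) (k + 1)" by simp
    have "0 = (eval_pmat (Lhat k \<otimes>\<^sub>k 1\<^sub>m n) l *\<^sub>v u) $ (a * n + b)"
      unfolding 0 using block_index_less[OF a b] by simp
    also have "\<dots> = - u $ ((a + 1) * n + b) + l * u $ ((a + 2) * n + b)"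
      unfolding eval_pmat_kron_one kron_one_mult_vec[OF E u a b] by (rule sum_Lhat_row[OF a])
    finally show ?thesis by simp
  qed
  \<comment> \<open>Induction on the distance \<open>m\<close> from the last block. The strict bound
    stops at block 1, as no row constrains block 0.\<close>
  have "u $ ((k - m) * n + b) = l ^ m * u $ (k * n + b)" if "m < k" for m
    using that
  proof (induction m)
    case (Suc m)
    \<comment> \<open>This is the row of \<open>Lhat\<close> that links blocks
      \<open>k - Suc m\<close> and \<open>k - m\<close>.\<close>
    define a where "a = k - Suc m - 1"
    have "a + 1 = k - Suc m" "a + 2 = k - m" "a < k - 1" using Suc.prems by (auto simp: a_def)
    with step[of a] Suc show ?case by (simp only: power_Suc mult.assoc)
  qed simp
  from this[of "k - j"] have *: "u $ (j * n + b) = l ^ (k - j) * u $ (k * n + b)" if "j > 0"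
    using that j by simp
  show "u $ i = (?M *\<^sub>v (?x @\<^sub>v ?y)) $ i"
    unfolding ij using b j *
    by (subst Lambdahat_mult_append_vec) (auto simp: vec_block_def)
qed

text \<open>Rows 1 to \<open>k - 1\<close> of the transpose form a lower triangular matrix with -1
  on the diagonal, so forward substitution gives zero for every value of \<open>l\<close>.\<close>

lemma Lhat_transpose_injective:
  fixes l :: "'a::field alg_closure"
  assumes w: "w \<in> carrier_vec ((k - 1) * n)"
    and 0: "eval_pmat (transpose_mat (Lhat k) \<otimes>\<^sub>k 1\<^sub>m n) l *\<^sub>v w = 0\<^sub>v ((k + 1) * n)"
  shows "w = 0\<^sub>v ((k - 1) * n)"
proof -
  have E: "eval_pmat (transpose_mat (Lhat k) :: 'a poly mat) l \<in> carrier_mat (k + 1) (k - 1)"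
    by simp
  have w0: "w $ (a * n + b) = 0" if "a < k - 1" and b: "b < n" for a b
    using that(1)
  proof (induction a rule: less_induct)
    case (less a)
    then have a: "a + 1 < k + 1" by simp
    have "0 = (eval_pmat (transpose_mat (Lhat k) \<otimes>\<^sub>k 1\<^sub>m n) l *\<^sub>v w) $ ((a + 1) * n + b)"
      unfolding 0 using block_index_less[OF a b] by simp
    also have "\<dots> = (\<Sum>j<k - 1. eval_pmat (transpose_mat (Lhat k)) l $$ (a + 1, j) * w $ (j * n + b))"
      unfolding eval_pmat_kron_one by (rule kron_one_mult_vec[OF E w a b])
    \<comment> \<open>The other possible nonzero coefficient sits at \<open>j = a - 1\<close>, where
      \<open>w\<close> vanishes by the induction hypothesis.\<close>
    also have "\<dots> = (\<Sum>j<k - 1. if j = a then - w $ (a * n + b) else 0)"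
    proof (rule sum.cong[OF refl])
      fix j assume j: "j \<in> {..<k - 1}"
      show "eval_pmat (transpose_mat (Lhat k)) l $$ (a + 1, j) * w $ (j * n + b)
        = (if j = a then - w $ (a * n + b) else 0)"
        using j a less.IH[of j] less.prems
        by (auto simp: eval_pmat_def Lhat_def eval_ac.hom_uminus)
    qed
    also have "\<dots> = - w $ (a * n + b)" using less.prems by simp
    finally show ?case by simp
  qed
  show ?thesis
  proof (rule eq_vecI)
    fix i assume "i < dim_vec (0\<^sub>v ((k - 1) * n) :: 'a alg_closure vec)"
    then have i: "i < (k - 1) * n" by simp
    then have "n > 0" by (auto intro: gr0I)
    with i w0[of "i div n" "i mod n"] show "w $ i = 0\<^sub>v ((k - 1) * n) $ i"
      by (simp add: less_mult_imp_div_less)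
  qed (use w in simp)
qed

section \<open>Auxiliary linear algebra\<close>

lemma invertible_mat_to_ac_inj:
  fixes M :: "'a::field mat"
  assumes M: "M \<in> carrier_mat n n" and inv: "invertible_mat M" and x: "x \<in> carrier_vec n"
    and 0: "map_mat to_ac M *\<^sub>v x = 0\<^sub>v n"
  shows "x = 0\<^sub>v n"
proof -
  from inv obtain N where MN: "M * N = 1\<^sub>m (dim_row M)" and NM: "N * M = 1\<^sub>m (dim_row N)"
    unfolding invertible_mat_def inverts_mat_def by auto
  \<comment> \<open>The definition of \<open>invertible_mat\<close> leaves the size of the inverse
    open; the two identity products force it to be \<open>n\<close> by \<open>n\<close>.\<close>
  from M MN have "dim_col N = n" by (metis carrier_matD(1) index_mult_mat(3) index_one_mat(3))
  moreover from M NM have "dim_row N = n"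
    by (metis carrier_matD(2) index_mult_mat(3) index_one_mat(3))
  ultimately have N: "N \<in> carrier_mat n n" by auto
  \<comment> \<open>The embedding carries the left inverse over the base field to a left inverse
    over the closure.\<close>
  have "x = map_mat to_ac (N * M) *\<^sub>v x" using NM N x by (simp add: to_ac.mat_hom_one)
  also have "\<dots> = map_mat to_ac N *\<^sub>v (map_mat to_ac M *\<^sub>v x)"
    unfolding to_ac.mat_hom_mult[OF N M] using N M x by (intro assoc_mult_mat_vec) auto
  also have "\<dots> = 0\<^sub>v n" unfolding 0 using N by auto
  finally show ?thesis .
qed

text \<open>Allows the sign \<open>\<sigma>\<close> of the lower left block to be pulled out of the
  Kronecker product and later cancelled.\<close>

lemma kron_smult_left:
  fixes M N :: "'a::comm_semiring_1 mat"
  shows "(c \<cdot>\<^sub>m M) \<otimes>\<^sub>k N = c \<cdot>\<^sub>m (M \<otimes>\<^sub>k N)"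
proof (rule eq_matI)
  fix i j
  assume "i < dim_row (c \<cdot>\<^sub>m (M \<otimes>\<^sub>k N))" "j < dim_col (c \<cdot>\<^sub>m (M \<otimes>\<^sub>k N))"
  then have ij: "i < dim_row M * dim_row N" "j < dim_col M * dim_col N" by (auto simp: kron_def)
  then have "i div dim_row N < dim_row M" "j div dim_col N < dim_col M"
    by (auto intro: less_mult_imp_div_less)
  with ij show "((c \<cdot>\<^sub>m M) \<otimes>\<^sub>k N) $$ (i, j) = (c \<cdot>\<^sub>m (M \<otimes>\<^sub>k N)) $$ (i, j)"
    by (simp add: kron_def mult.assoc)
qed (auto simp: kron_def)

lemma zero_mat_mult_vec:
  fixes v :: "'a::semiring_0 vec"
  assumes "v \<in> carrier_vec c"
  shows "0\<^sub>m r c *\<^sub>v v = 0\<^sub>v r"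
  using assms by (intro eq_vecI) (auto simp: scalar_prod_def)

lemma mult_mat_vec_zero:
  fixes M :: "'a::semiring_0 mat"
  assumes "M \<in> carrier_mat r c"
  shows "M *\<^sub>v 0\<^sub>v c = 0\<^sub>v r"
  using assms by (intro eq_vecI) auto

lemma smult_mat_mult_vec:
  fixes M :: "'a::semiring_0 mat"
  assumes "dim_vec v = dim_col M"
  shows "(c \<cdot>\<^sub>m M) *\<^sub>v v = c \<cdot>\<^sub>v (M *\<^sub>v v)"
  using assms by (intro eq_vecI) (auto simp: scalar_prod_def sum_distrib_left mult.assoc)

lemma append_vec_eq_zero:
  assumes "x \<in> carrier_vec m" "x @\<^sub>v y = 0\<^sub>v (m + k)"
  shows "x = 0\<^sub>v m" "y = 0\<^sub>v k"
proof -
  have "(0\<^sub>v (m + k) :: 'a::zero vec) = 0\<^sub>v m @\<^sub>v 0\<^sub>v k" by (rule eq_vecI) auto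
  with assms show "x = 0\<^sub>v m" "y = 0\<^sub>v k" using append_vec_eq[of x m "0\<^sub>v m"] by auto
qed

theorem theorem7p5:
  fixes C :: "nat \<Rightarrow> 'a::field mat"
    and P L :: "'a poly mat"
    and A B :: "'a mat"
    and \<sigma> :: 'a
    and l0 :: "'a alg_closure"
    and z :: "'a vec"
    and n d t :: nat
  assumes "n \<ge> 1"
    and "even d" and "d \<ge> 2" and "t = d div 2"
    and "\<And>k. k \<le> d \<Longrightarrow> C k \<in> carrier_mat n n"
    and "P = matrix_poly n d C"
    and "regular_pmat P"
    and "invertible_mat (C d)"
    and "\<sigma> = 1 \<or> \<sigma> = - 1"
    and "A \<in> carrier_mat ((t + 1) * n) ((t + 1) * n)"
    and "B \<in> carrier_mat ((t + 1) * n) ((t + 1) * n)"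
    and "(Lambdahat_T t \<otimes>\<^sub>k 1\<^sub>m n) * pencil B A * (transpose_mat (Lambdahat_T t) \<otimes>\<^sub>k 1\<^sub>m n) =
      four_block_mat
        (const_pmat (- C d)) (Polynomial.monom 1 t \<cdot>\<^sub>m const_pmat (C d))
        (Polynomial.monom 1 t \<cdot>\<^sub>m const_pmat (C d)) (P - Polynomial.monom 1 d \<cdot>\<^sub>m const_pmat (C d))"
    and "L = modified_block_kronecker n t \<sigma> B A"
    and "strong_linearization d P L"
    and "z \<in> carrier_vec (n * d)"
    and "right_eigenvector L l0 (map_vec to_ac z)"
  shows "right_eigenvector P l0 (vec_block n (t + 1) (map_vec to_ac z))"
proof -
  note Ccar = assms(5) and P = assms(6) and reg = assms(7)
    and inv = assms(8) and \<sigma> = assms(9) and A = assms(10) and B = assms(11) and key = assms(12)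
    and L = assms(13) and z = assms(15) and eig = assms(16)

  \<comment> \<open>Block sizes and evaluation at the eigenvalue\<close>
  define E where "E R = eval_pmat R l0" for R :: "'a poly mat"
  define y where "y = map_vec to_ac z"
  define N where "N = (t + 1) * n"
  define N' where "N' = (t - 1) * n"
  have d: "d = t + t" and t1: "t \<ge> 1" using assms(2-4) by auto
  \<comment> \<open>The block counts \<open>t + 1\<close> and \<open>t - 1\<close> add up to
    \<open>d\<close> because \<open>t \<ge> 1\<close> prevents truncation.\<close>
  have nd: "n * d = N + N'"
    using t1 unfolding N_def N'_def d by (cases t) (auto simp: algebra_simps)
  have Cd: "C d \<in> carrier_mat n n" by (rule Ccar) simp
  have Pcar: "P \<in> carrier_mat n n" unfolding P matrix_poly_def by simp
  let ?M = "pencil B A"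
  let ?Lh = "Lhat t \<otimes>\<^sub>k 1\<^sub>m n :: 'a poly mat"
  let ?LhT = "transpose_mat (Lhat t) \<otimes>\<^sub>k 1\<^sub>m n :: 'a poly mat"
  let ?La = "transpose_mat (Lambdahat_T t) \<otimes>\<^sub>k 1\<^sub>m n :: 'a poly mat"
  let ?LaT = "Lambdahat_T t \<otimes>\<^sub>k 1\<^sub>m n :: 'a poly mat"
  have M: "?M \<in> carrier_mat N N"
    using A B unfolding pencil_def const_pmat_def N_def by auto
  have Lh: "?Lh \<in> carrier_mat N' N" unfolding N_def N'_def by (intro kron_carrier) auto
  have LhT: "?LhT \<in> carrier_mat N N'" unfolding N_def N'_def by (intro kron_carrier) auto
  have La: "?La \<in> carrier_mat N (n + n)"
    unfolding N_def mult_2[symmetric] by (intro kron_carrier) auto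
  have LaT: "?LaT \<in> carrier_mat (n + n) N"
    unfolding N_def mult_2[symmetric] by (intro kron_carrier) auto
  have Ecar: "E R \<in> carrier_mat r c" if "R \<in> carrier_mat r c" for R r c
    using that unfolding E_def by simp

  have Lfour: "L = four_block_mat ?M ?LhT ([:\<sigma>:] \<cdot>\<^sub>m ?Lh) (0\<^sub>m N' N')"
    unfolding L modified_block_kronecker_def kron_smult_left N'_def ..
  have EL: "E L = four_block_mat (E ?M) (E ?LhT) (to_ac \<sigma> \<cdot>\<^sub>m E ?Lh) (0\<^sub>m N' N')"
  proof -
    have "E L = four_block_mat (E ?M) (E ?LhT) (E ([:\<sigma>:] \<cdot>\<^sub>m ?Lh)) (E (0\<^sub>m N' N'))"
      unfolding Lfour E_def unfolding eval_pmat_def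
      by (rule map_four_block_mat[OF M LhT smult_carrier_mat[OF Lh] zero_carrier_mat])
    then show ?thesis by (simp add: E_def eval_pmat_smult)
  qed
  have Lcar: "L \<in> carrier_mat (N + N') (N + N')"
    unfolding Lfour using M by auto
  have y: "y \<in> carrier_vec (N + N')" using z unfolding y_def nd[symmetric] by simp
  have ynz: "y \<noteq> 0\<^sub>v (N + N')" and Ly: "E L *\<^sub>v y = 0\<^sub>v (N + N')"
    using eig Lcar unfolding right_eigenvector_def y_def[symmetric] E_def by auto

  \<comment> \<open>Block rows of the eigenvector equation\<close>
  define u where "u = vec_first y N"
  define w where "w = vec_last y N'"
  have u: "u \<in> carrier_vec N" and w: "w \<in> carrier_vec N'"
    unfolding u_def w_def by simp_all
  have yuw: "y = u @\<^sub>v w" unfolding u_def w_def using y by simp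
  have Eu: "E ?M *\<^sub>v u \<in> carrier_vec N" and Ew: "E ?LhT *\<^sub>v w \<in> carrier_vec N"
    and Ehu: "E ?Lh *\<^sub>v u \<in> carrier_vec N'"
    using Ecar[OF M] Ecar[OF LhT] Ecar[OF Lh] u w by auto
  have "(E ?M *\<^sub>v u + E ?LhT *\<^sub>v w) @\<^sub>v ((to_ac \<sigma> \<cdot>\<^sub>m E ?Lh) *\<^sub>v u + 0\<^sub>m N' N' *\<^sub>v w) = 0\<^sub>v (N + N')"
    using Ly four_block_mat_mult_vec[OF Ecar[OF M] Ecar[OF LhT] smult_carrier_mat[OF Ecar[OF Lh]]
        zero_carrier_mat u w, of "to_ac \<sigma>"]
    unfolding EL yuw by simp
  note rows = append_vec_eq_zero[OF _ this]
  have upper: "E ?M *\<^sub>v u + E ?LhT *\<^sub>v w = 0\<^sub>v N"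
    using Eu Ew by (intro rows(1)) auto
  have "(to_ac \<sigma> \<cdot>\<^sub>m E ?Lh) *\<^sub>v u + 0\<^sub>m N' N' *\<^sub>v w = 0\<^sub>v N'"
    using Eu Ew by (intro rows(2)) auto
  then have "to_ac \<sigma> \<cdot>\<^sub>v (E ?Lh *\<^sub>v u) = 0\<^sub>v N'"
    using Ecar[OF Lh] u w Ehu by (simp add: smult_mat_mult_vec zero_mat_mult_vec)
  \<comment> \<open>The sign is nonzero in the closure, so it cancels from the lower block
    row.\<close>
  moreover have "to_ac \<sigma> \<noteq> 0" using \<sigma> by auto
  ultimately have lower: "E ?Lh *\<^sub>v u = 0\<^sub>v N'" using Ehu by (auto simp: vec_eq_iff)

  \<comment> \<open>Parametrization of the upper part by two blocks\<close>
  define x where "x = vec_block n 1 u"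
  define v where "v = vec_block n (t + 1) u"
  have x: "x \<in> carrier_vec n" and v: "v \<in> carrier_vec n"
    unfolding x_def v_def vec_block_def by simp_all
  have xv: "x @\<^sub>v v \<in> carrier_vec (n + n)" using x v by simp
  have ux: "u = E ?La *\<^sub>v (x @\<^sub>v v)"
    using Lhat_kernel[of u t n l0] u lower unfolding E_def x_def v_def N_def N'_def by simp

  \<comment> \<open>Elimination of the lower part\<close>
  have "?LaT * ?LhT = 0\<^sub>m (n + n) N'"
  proof -
    \<comment> \<open>The mixed-product property reduces the claim to the scalar duality
      \<open>Lambdahat_T_mult_Lhat\<close>.\<close>
    have "?LaT * ?LhT = (Lambdahat_T t * transpose_mat (Lhat t)) \<otimes>\<^sub>k (1\<^sub>m n * 1\<^sub>m n)"
      by (rule kron_mult_kron[of _ 2 "t + 1" _ "t - 1" _ n n _ n]) auto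
    then show ?thesis
      by (auto simp: Lambdahat_T_mult_Lhat kron_def N'_def mult_2 less_mult_imp_div_less intro!: eq_matI)
  qed
  then have "E ?LaT * E ?LhT = 0\<^sub>m (n + n) N'"
    using eval_pmat_mult[OF LaT LhT, of l0] unfolding E_def by simp
  then have ann: "E ?LaT *\<^sub>v (E ?LhT *\<^sub>v w) = 0\<^sub>v (n + n)"
    using assoc_mult_mat_vec[OF Ecar[OF LaT] Ecar[OF LhT] w] w by (simp add: zero_mat_mult_vec)
  have "E ?LaT *\<^sub>v (E ?M *\<^sub>v u) = 0\<^sub>v (n + n)"
  proof -
    have "0\<^sub>v (n + n) = E ?LaT *\<^sub>v (E ?M *\<^sub>v u + E ?LhT *\<^sub>v w)"
      unfolding upper using Ecar[OF LaT] by auto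
    also have "\<dots> = E ?LaT *\<^sub>v (E ?M *\<^sub>v u) + E ?LaT *\<^sub>v (E ?LhT *\<^sub>v w)"
      by (rule mult_add_distrib_mat_vec[OF Ecar[OF LaT] Eu Ew])
    also have "\<dots> = E ?LaT *\<^sub>v (E ?M *\<^sub>v u)"
      unfolding ann using Ecar[OF LaT] Eu by simp
    finally show ?thesis by simp
  qed
  \<comment> \<open>Inserting the parametrization \<open>ux\<close> produces the triple product
    whose value is prescribed by \<open>key\<close>.\<close>
  moreover have "E (?LaT * ?M * ?La) *\<^sub>v (x @\<^sub>v v) = E ?LaT *\<^sub>v (E ?M *\<^sub>v u)"
  proof -
    have "E (?LaT * ?M * ?La) = E ?LaT * E ?M * E ?La"
      unfolding E_def eval_pmat_mult[OF mult_carrier_mat[OF LaT M] La] eval_pmat_mult[OF LaT M] ..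
    then show ?thesis
      using assoc_mult_mat_vec[OF mult_carrier_mat[OF Ecar[OF LaT] Ecar[OF M]] Ecar[OF La] xv]
        assoc_mult_mat_vec[OF Ecar[OF LaT] Ecar[OF M] u] unfolding ux by simp
  qed
  ultimately have red: "E (?LaT * ?M * ?La) *\<^sub>v (x @\<^sub>v v) = 0\<^sub>v (n + n)" by simp

  \<comment> \<open>The reduced two-by-two block system\<close>
  define D where "D = map_mat to_ac (C d)"
  have D: "D \<in> carrier_mat n n" using Cd unfolding D_def by simp
  have EP: "E P \<in> carrier_mat n n" by (rule Ecar[OF Pcar])
  have cC: "const_pmat (C d) \<in> carrier_mat n n" "const_pmat (- C d) \<in> carrier_mat n n"
    using Cd unfolding const_pmat_def by auto
  have nD: "map_mat to_ac (- C d) = - D"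
    using Cd unfolding D_def by (auto intro!: eq_matI)
  have "E (?LaT * ?M * ?La)
      = four_block_mat (- D) (l0 ^ t \<cdot>\<^sub>m D) (l0 ^ t \<cdot>\<^sub>m D) (E P - l0 ^ d \<cdot>\<^sub>m D)"
  proof -
    have "E (?LaT * ?M * ?La) = four_block_mat (E (const_pmat (- C d)))
        (E (Polynomial.monom 1 t \<cdot>\<^sub>m const_pmat (C d))) (E (Polynomial.monom 1 t \<cdot>\<^sub>m const_pmat (C d)))
        (E (P - Polynomial.monom 1 d \<cdot>\<^sub>m const_pmat (C d)))"
      unfolding key E_def unfolding eval_pmat_def
      by (rule map_four_block_mat[of _ n n _ n _ n]) (use cC Pcar in auto)
    then show ?thesis
      using eval_pmat_diff[OF Pcar smult_carrier_mat[OF cC(1)]]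
      by (simp add: E_def eval_pmat_smult poly_monom nD D_def[symmetric])
  qed
  with red have "(- D *\<^sub>v x + (l0 ^ t \<cdot>\<^sub>m D) *\<^sub>v v) @\<^sub>v
      ((l0 ^ t \<cdot>\<^sub>m D) *\<^sub>v x + (E P - l0 ^ d \<cdot>\<^sub>m D) *\<^sub>v v) = 0\<^sub>v (n + n)"
    using four_block_mat_mult_vec[of "- D" n n "l0 ^ t \<cdot>\<^sub>m D" n "l0 ^ t \<cdot>\<^sub>m D" n
        "E P - l0 ^ d \<cdot>\<^sub>m D" x v] D EP x v
      minus_carrier_mat[OF smult_carrier_mat[OF D]] by simp
  note rows = append_vec_eq_zero[OF _ this]
  have r1: "- D *\<^sub>v x + (l0 ^ t \<cdot>\<^sub>m D) *\<^sub>v v = 0\<^sub>v n"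
    using D x v by (intro rows(1) carrier_vecI) auto
  have r2: "(l0 ^ t \<cdot>\<^sub>m D) *\<^sub>v x + (E P - l0 ^ d \<cdot>\<^sub>m D) *\<^sub>v v = 0\<^sub>v n"
    using D x v by (intro rows(2) carrier_vecI) auto
  have Dx: "D *\<^sub>v x \<in> carrier_vec n" and Dv: "D *\<^sub>v v \<in> carrier_vec n"
    and EPv: "E P *\<^sub>v v \<in> carrier_vec n" using D EP x v by auto
  \<comment> \<open>The first block equation, solved for \<open>D *\<^sub>v x\<close>; it serves
    both to eliminate \<open>x\<close> from the second equation and to show later that
    \<open>v\<close> is nonzero.\<close>
  have e1: "(D *\<^sub>v x) $ i = l0 ^ t * (D *\<^sub>v v) $ i" if "i < n" for i
  proof -
    have "(- D *\<^sub>v x + (l0 ^ t \<cdot>\<^sub>m D) *\<^sub>v v) $ i = 0" using r1 that by simp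
    then show ?thesis using that D x v by (simp add: uminus_mult_mat_vec smult_mat_mult_vec)
  qed
  have Pv: "E P *\<^sub>v v = 0\<^sub>v n"
  proof (rule eq_vecI)
    fix i assume "i < dim_vec (0\<^sub>v n :: 'a alg_closure vec)"
    then have i: "i < n" by simp
    have "(E P - l0 ^ d \<cdot>\<^sub>m D) *\<^sub>v v = E P *\<^sub>v v - l0 ^ d \<cdot>\<^sub>v (D *\<^sub>v v)"
      using D EP v by (simp add: minus_mult_distrib_mat_vec smult_mat_mult_vec)
    then have "(l0 ^ t \<cdot>\<^sub>v (D *\<^sub>v x) + (E P *\<^sub>v v - l0 ^ d \<cdot>\<^sub>v (D *\<^sub>v v))) $ i = 0"
      using r2 i D x by (simp add: smult_mat_mult_vec)
    then have "l0 ^ t * (D *\<^sub>v x) $ i + ((E P *\<^sub>v v) $ i - l0 ^ d * (D *\<^sub>v v) $ i) = 0"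
      using i D EP by (simp del: index_mult_mat_vec)
    \<comment> \<open>As \<open>d = t + t\<close>, substituting \<open>e1\<close> gives
      \<open>l0 ^ t * l0 ^ t = l0 ^ d\<close> as the coefficient of \<open>D *\<^sub>v v\<close>,
      which cancels the subtracted term.\<close>
    then have "(E P *\<^sub>v v) $ i = 0" unfolding e1[OF i] d power_add by (simp add: mult.assoc)
    then show "(E P *\<^sub>v v) $ i = 0\<^sub>v n $ i" using i by simp
  qed (use EP in simp)

  \<comment> \<open>Nonvanishing and location of the last block of \<open>u\<close>\<close>
  have "v \<noteq> 0\<^sub>v n"
  proof
    assume v0: "v = 0\<^sub>v n"
    have "D *\<^sub>v x = 0\<^sub>v n"
      using e1 Dx D unfolding v0 by (intro eq_vecI) auto
    then have x0: "x = 0\<^sub>v n"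
      using invertible_mat_to_ac_inj[OF Cd inv x] unfolding D_def by simp
    have "x @\<^sub>v v = 0\<^sub>v (n + n)" unfolding x0 v0 by (auto intro!: eq_vecI)
    then have u0: "u = 0\<^sub>v N" unfolding ux using mult_mat_vec_zero[OF Ecar[OF La]] by simp
    have "E ?LhT *\<^sub>v w = 0\<^sub>v N"
      using upper Ew mult_mat_vec_zero[OF Ecar[OF M]] unfolding u0 by simp
    then have w0: "w = 0\<^sub>v N'"
      using Lhat_transpose_injective[of w t n l0] w unfolding E_def N_def N'_def by simp
    have "y = 0\<^sub>v (N + N')" unfolding yuw u0 w0 by (auto intro!: eq_vecI)
    with ynz show False ..
  qed
  \<comment> \<open>Block \<open>t + 1\<close> ends exactly at position \<open>N\<close>, so it lies
    entirely in \<open>u\<close> and does not reach into \<open>w\<close>.\<close>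
  moreover have "vec_block n (t + 1) y = v"
  proof -
    have "t * n + j < N" if "j < n" for j using that unfolding N_def by simp
    then show ?thesis
      unfolding v_def yuw vec_block_def using u w
      by (intro eq_vecI) (auto simp: trans_less_add1)
  qed
  ultimately show ?thesis
    unfolding right_eigenvector_def y_def[symmetric] using reg Pcar v Pv unfolding E_def by auto
qed

end
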